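(* Let $P$ be a doubly-stochastic $n\times n$ matrix, let $m$ be an integer with $1\le m\le n$, and let $t=\frac mn$. Then $$\mathrm{per}_m(P)\ \ge\ \frac{\left(\prod_{1\le i,j\le n}\left(1-\frac mn P(i,j)\right)^{1-\frac mn P(i,j)}\right) G(n)^{2(n-m)}}{\left(\frac mn\right)^m n^{-2n(1-t)}\big((n(1-t))!\big)^2}.$$
   Context: A doubly-stochastic matrix is an entrywise non-negative square matrix all of whose row and column sums equal $1$. $\mathrm{per}_m(P)=\sum_{|S|=|T|=m}\mathrm{per}(P_{S,T})$ is the sum of the permanents of all $m\times m$ submatrices. $G(x)=\left(\frac{x-1}{x}\right)^{x-1}$ for $x\ge 1$. Convention $0^0=1$. *)

theory Defs
  imports "HOL-Analysis.Analysis" "HOL-Library.FuncSet"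
begin

definition doubly_stochastic :: "nat \<Rightarrow> (nat \<Rightarrow> nat \<Rightarrow> real) \<Rightarrow> bool" where
  "doubly_stochastic n P \<longleftrightarrow>
     (\<forall>i<n. \<forall>j<n. P i j \<ge> 0) \<and>
     (\<forall>i<n. (\<Sum>j<n. P i j) = 1) \<and>
     (\<forall>j<n. (\<Sum>i<n. P i j) = 1)"

definition per_sub :: "(nat \<Rightarrow> nat \<Rightarrow> real) \<Rightarrow> nat set \<Rightarrow> nat set \<Rightarrow> real" where
  "per_sub P S T = (\<Sum>f \<in> {f \<in> S \<rightarrow>\<^sub>E T. bij_betw f S T}. \<Prod>i\<in>S. P i (f i))"

definition per_m :: "nat \<Rightarrow> nat \<Rightarrow> (nat \<Rightarrow> nat \<Rightarrow> real) \<Rightarrow> real" where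
  "per_m n m P = (\<Sum>S \<in> {S. S \<subseteq> {..<n} \<and> card S = m}.
                   \<Sum>T \<in> {T. T \<subseteq> {..<n} \<and> card T = m}. per_sub P S T)"

text \<open>x^y with the convention 0^0 = 1 (x \<ge> 0).\<close>
definition rpow0 :: "real \<Rightarrow> real \<Rightarrow> real" where
  "rpow0 x y = (if x = 0 then (if y = 0 then 1 else 0) else x powr y)"

definition G :: "real \<Rightarrow> real" where
  "G x = rpow0 ((x - 1) / x) (x - 1)"

end

theory Submission
  imports Defs
begin

text \<open>
  The case \<open>m = n\<close> is the Schrijver--Gurvits inequality
  \<open>per Q \<ge> \<Prod> (1 - Q i j) powr (1 - Q i j)\<close>, proved here by the capacity method of Anari and
  Oveis Gharan. Introduce variables \<open>y i j\<close>, \<open>z i j\<close> for every edge. By weighted AM-GM,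
  \<open>\<Prod>\<^sub>i (\<Sum>\<^sub>j Q i j * y i j) * \<Prod>\<^sub>j (\<Sum>\<^sub>i Q i j * z i j)\<close> is at least \<open>\<Prod> (y i j * z i j) powr Q i j\<close>.
  One removes the two variables of one edge at a time, replacing their product by \<open>1 / Q i j\<close> and
  setting them to 0 elsewhere. All intermediate polynomials are weighted matching polynomials, and
  the factor lost in one step is at most \<open>(1 - Q i j) powr (1 - Q i j)\<close> because
  vertices on opposite sides of a bipartite graph are correlated (a Heilmann--Lieb type inequality).
  When all the variables are gone, the permanent of \<open>Q\<close> is left. For general \<open>m\<close>, apply this to
  the matrix of size \<open>2 n - m\<close> obtained by bordering \<open>t P\<close> with \<open>n - m\<close> rows and columns of
  entries \<open>1 / n\<close>, whose permanent is a multiple of \<open>per_m n m P\<close>.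
\<close>

section \<open>Weighted matching polynomials of bipartite graphs\<close>

definition matchings :: "'a set \<Rightarrow> 'b set \<Rightarrow> ('a \<times> 'b) set set" where
  "matchings S T = {M. M \<subseteq> S \<times> T \<and> single_valued M \<and> single_valued (M\<inverse>)}"

text \<open>The monomer-dimer partition function: \<open>Y\<close> and \<open>Z\<close> weigh
  unmatched vertices, \<open>w\<close> weighs matched edges. It interpolates between a product of
  vertex weights (\<open>w = 0\<close>) and the permanent (\<open>Y = Z = 0\<close>); the
  elimination moves from the first extreme to the second.\<close>

definition matching_poly ::
  "('a \<Rightarrow> real) \<Rightarrow> ('b \<Rightarrow> real) \<Rightarrow> ('a \<Rightarrow> 'b \<Rightarrow> real) \<Rightarrow> 'a set \<Rightarrow> 'b set \<Rightarrow> real" where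
  "matching_poly Y Z w S T = (\<Sum>M\<in>matchings S T.
     (\<Prod>(i,j)\<in>M. w i j) * (\<Prod>i\<in>S - fst ` M. Y i) * (\<Prod>j\<in>T - snd ` M. Z j))"

lemma finite_matchings: "finite S \<Longrightarrow> finite T \<Longrightarrow> finite (matchings S T)"
  by (rule finite_subset[of _ "Pow (S \<times> T)"]) (auto simp: matchings_def)

lemma matching_poly_cong:
  assumes "\<And>i. i \<in> S \<Longrightarrow> Y i = Y' i" "\<And>j. j \<in> T \<Longrightarrow> Z j = Z' j"
    "\<And>i j. i \<in> S \<Longrightarrow> j \<in> T \<Longrightarrow> w i j = w' i j"
  shows "matching_poly Y Z w S T = matching_poly Y' Z' w' S T"
  unfolding matching_poly_def
proof (intro sum.cong refl)
  fix M assume "M \<in> matchings S T"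
  hence M: "M \<subseteq> S \<times> T" by (auto simp: matchings_def)
  have "(\<Prod>(i,j)\<in>M. w i j) = (\<Prod>(i,j)\<in>M. w' i j)"
    using M assms(3) by (intro prod.cong) auto
  moreover have "(\<Prod>i\<in>S - fst ` M. Y i) = (\<Prod>i\<in>S - fst ` M. Y' i)"
    using assms(1) by (intro prod.cong) auto
  moreover have "(\<Prod>j\<in>T - snd ` M. Z j) = (\<Prod>j\<in>T - snd ` M. Z' j)"
    using assms(2) by (intro prod.cong) auto
  ultimately show "(\<Prod>(i,j)\<in>M. w i j) * (\<Prod>i\<in>S - fst ` M. Y i) * (\<Prod>j\<in>T - snd ` M. Z j) =
    (\<Prod>(i,j)\<in>M. w' i j) * (\<Prod>i\<in>S - fst ` M. Y' i) * (\<Prod>j\<in>T - snd ` M. Z' j)" by simp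
qed

lemma matching_poly_nonneg:
  assumes "\<And>i. i \<in> S \<Longrightarrow> Y i \<ge> 0" "\<And>j. j \<in> T \<Longrightarrow> Z j \<ge> 0"
    "\<And>i j. i \<in> S \<Longrightarrow> j \<in> T \<Longrightarrow> w i j \<ge> 0"
  shows "matching_poly Y Z w S T \<ge> 0"
  unfolding matching_poly_def
proof (intro sum_nonneg mult_nonneg_nonneg prod_nonneg)
  fix M e assume "M \<in> matchings S T" "e \<in> M"
  hence "e \<in> S \<times> T" by (auto simp: matchings_def)
  thus "0 \<le> (case e of (i, j) \<Rightarrow> w i j)" using assms(3) by (cases e) simp
qed (simp_all add: assms)

text \<open>Reversing all edges is a bijection on matchings, so facts transfer between rows and
  columns.\<close>

lemma matching_poly_transpose:
  "matching_poly Y Z w S T = matching_poly Z Y (\<lambda>j i. w i j) T S"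
  unfolding matching_poly_def
proof (rule sum.reindex_bij_witness[where i = converse and j = converse])
  fix M :: "('a \<times> 'b) set"
  assume M: "M \<in> matchings S T"
  show "M\<inverse> \<in> matchings T S"
    using M by (auto simp: matchings_def single_valued_def)
  have "(\<Prod>(j,i)\<in>M\<inverse>. w i j) = (\<Prod>(i,j)\<in>M. w i j)"
    by (rule prod.reindex_bij_witness[where i = prod.swap and j = prod.swap]) auto
  moreover have "fst ` (M\<inverse>) = snd ` M" "snd ` (M\<inverse>) = fst ` M" by force+
  ultimately show "(\<Prod>(j,i)\<in>M\<inverse>. w i j) * (\<Prod>j\<in>T - fst ` (M\<inverse>). Z j) * (\<Prod>i\<in>S - snd ` (M\<inverse>). Y i) =
    (\<Prod>(i,j)\<in>M. w i j) * (\<Prod>i\<in>S - fst ` M. Y i) * (\<Prod>j\<in>T - snd ` M. Z j)" by simp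
next
  fix M :: "('b \<times> 'a) set"
  assume M: "M \<in> matchings T S"
  show "M\<inverse> \<in> matchings S T"
    using M by (auto simp: matchings_def single_valued_def)
qed auto

lemma matchings_split_column:
  assumes "j \<in> T"
  shows "matchings S T = matchings S (T - {j}) \<union>
           (\<Union>k\<in>S. insert (k, j) ` matchings (S - {k}) (T - {j}))" (is "?L = ?A \<union> ?B")
proof
  show "?L \<subseteq> ?A \<union> ?B"
  proof
    fix M assume M: "M \<in> ?L"
    show "M \<in> ?A \<union> ?B"
    proof (cases "j \<in> snd ` M")
      case False
      hence "M \<in> ?A" using M by (force simp: matchings_def)
      thus ?thesis by blast
    next
      case True
      then obtain k where k: "(k, j) \<in> M" by auto
      have "M - {(k, j)} \<in> matchings (S - {k}) (T - {j})"
        using M k by (auto simp: matchings_def single_valued_def)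
      moreover have "M = insert (k, j) (M - {(k, j)})" "k \<in> S" using k M by (auto simp: matchings_def)
      ultimately show ?thesis by blast
    qed
  qed
  show "?A \<union> ?B \<subseteq> ?L"
  proof (intro Un_least UN_least image_subsetI subsetI)
    fix M assume "M \<in> ?A"
    thus "M \<in> ?L" by (auto simp: matchings_def)
  next
    fix k M assume "k \<in> S" "M \<in> matchings (S - {k}) (T - {j})"
    thus "insert (k, j) M \<in> ?L"
      using assms by (auto simp: matchings_def single_valued_def)
  qed
qed

text \<open>Laplace expansion for matchings: \<open>j\<close> is either unmatched, at cost
  \<open>Z j\<close>, or matched to exactly one \<open>k\<close>, after which both endpoints are
  deleted.\<close>

lemma matching_poly_column:
  assumes fin: "finite S" "finite T" and j: "j \<in> T"
  shows "matching_poly Y Z w S T = Z j * matching_poly Y Z w S (T - {j}) +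
           (\<Sum>k\<in>S. w k j * matching_poly Y Z w (S - {k}) (T - {j}))"
proof -
  define h where "h S' T' M = (\<Prod>(i,j)\<in>M. w i j) * (\<Prod>i\<in>S' - fst ` M. Y i) * (\<Prod>j\<in>T' - snd ` M. Z j)"
    for S' T' M
  have mp: "matching_poly Y Z w S' T' = (\<Sum>M\<in>matchings S' T'. h S' T' M)" for S' T'
    by (simp add: matching_poly_def h_def)
  let ?N = "\<lambda>k. insert (k, j) ` matchings (S - {k}) (T - {j})"
  have finM: "finite (matchings S' T')" if "S' \<subseteq> S" "T' \<subseteq> T" for S' T'
    using that fin by (meson finite_matchings finite_subset)
  have 1: "(\<Sum>M\<in>matchings S (T - {j}). h S T M) = Z j * matching_poly Y Z w S (T - {j})"
    unfolding mp sum_distrib_left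
  proof (intro sum.cong refl)
    fix M assume "M \<in> matchings S (T - {j})"
    hence "j \<notin> snd ` M" by (auto simp: matchings_def)
    hence "T - snd ` M = insert j (T - {j} - snd ` M)" using j by auto
    hence "(\<Prod>j\<in>T - snd ` M. Z j) = Z j * (\<Prod>j\<in>T - {j} - snd ` M. Z j)"
      using fin by simp
    thus "h S T M = Z j * h S (T - {j}) M" by (simp add: h_def)
  qed
  have 2: "(\<Sum>M\<in>?N k. h S T M) = w k j * matching_poly Y Z w (S - {k}) (T - {j})"
    if k: "k \<in> S" for k
  proof -
    have "inj_on (insert (k, j)) (matchings (S - {k}) (T - {j}))"
    proof (rule inj_onI)
      fix M N assume MN: "M \<in> matchings (S - {k}) (T - {j})" "N \<in> matchings (S - {k}) (T - {j})"
        "insert (k, j) M = insert (k, j) N"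
      hence "(k, j) \<notin> M" "(k, j) \<notin> N" by (auto simp: matchings_def)
      thus "M = N" using MN(3) insert_ident by metis
    qed
    hence "(\<Sum>M\<in>?N k. h S T M) = (\<Sum>M\<in>matchings (S - {k}) (T - {j}). h S T (insert (k, j) M))"
      by (simp add: sum.reindex)
    also have "\<dots> = (\<Sum>M\<in>matchings (S - {k}) (T - {j}). w k j * h (S - {k}) (T - {j}) M)"
    proof (intro sum.cong refl)
      fix M assume M: "M \<in> matchings (S - {k}) (T - {j})"
      hence "M \<subseteq> (S - {k}) \<times> (T - {j})" by (simp add: matchings_def)
      hence "finite M" using fin by (meson finite_Diff finite_SigmaI finite_subset)
      moreover have "(k, j) \<notin> M" using M by (auto simp: matchings_def)
      moreover have "S - fst ` insert (k, j) M = S - {k} - fst ` M"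
        "T - snd ` insert (k, j) M = T - {j} - snd ` M" by auto
      ultimately show "h S T (insert (k, j) M) = w k j * h (S - {k}) (T - {j}) M"
        by (simp add: h_def)
    qed
    finally show ?thesis by (simp add: mp sum_distrib_left)
  qed
  have "matching_poly Y Z w S T =
      (\<Sum>M\<in>matchings S (T - {j}). h S T M) + (\<Sum>M\<in>(\<Union>k\<in>S. ?N k). h S T M)"
    unfolding mp matchings_split_column[OF j]
    by (rule sum.union_disjoint) (use finM fin in \<open>auto simp: matchings_def\<close>)
  also have "(\<Sum>M\<in>(\<Union>k\<in>S. ?N k). h S T M) = (\<Sum>k\<in>S. \<Sum>M\<in>?N k. h S T M)"
  proof (rule sum.UNION_disjoint)
    show "\<forall>k\<in>S. \<forall>k'\<in>S. k \<noteq> k' \<longrightarrow> ?N k \<inter> ?N k' = {}"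
    proof (intro ballI impI)
      fix k k' assume kk: "k \<in> S" "k' \<in> S" "k \<noteq> k'"
      have "(k', j) \<notin> M" if "M \<in> ?N k" for M
        using that kk by (auto simp: matchings_def)
      thus "?N k \<inter> ?N k' = {}" by blast
    qed
  qed (use fin finM in auto)
  finally show ?thesis by (simp add: 1 2)
qed

lemma matching_poly_row:
  assumes "finite S" "finite T" "i \<in> S"
  shows "matching_poly Y Z w S T = Y i * matching_poly Y Z w (S - {i}) T +
           (\<Sum>l\<in>T. w i l * matching_poly Y Z w (S - {i}) (T - {l}))"
  using matching_poly_column[OF assms(2,1,3), of Z Y "\<lambda>j i. w i j"]
  unfolding matching_poly_transpose[of Y Z w] .

text \<open>Every nonempty matching carries a factor 0. This evaluates the starting point of the
  elimination and the permanent without rows.\<close>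

lemma matching_poly_no_edges:
  assumes "finite S" "finite T" and w: "\<And>i j. i \<in> S \<Longrightarrow> j \<in> T \<Longrightarrow> w i j = 0"
  shows "matching_poly Y Z w S T = (\<Prod>i\<in>S. Y i) * (\<Prod>j\<in>T. Z j)"
proof -
  have "matching_poly Y Z w S T = (\<Sum>M\<in>{{}}.
     (\<Prod>(i,j)\<in>M. w i j) * (\<Prod>i\<in>S - fst ` M. Y i) * (\<Prod>j\<in>T - snd ` M. Z j))"
    unfolding matching_poly_def
  proof (rule sum.mono_neutral_right)
    show "\<forall>M\<in>matchings S T - {{}}. (\<Prod>(i,j)\<in>M. w i j) * (\<Prod>i\<in>S - fst ` M. Y i) * (\<Prod>j\<in>T - snd ` M. Z j) = 0"
    proof
      fix M assume M: "M \<in> matchings S T - {{}}"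
      hence sub: "M \<subseteq> S \<times> T" by (auto simp: matchings_def)
      hence "finite M" using assms(1,2) by (meson finite_SigmaI finite_subset)
      moreover have "M \<noteq> {}" using M by simp
      then obtain i j where ij: "(i, j) \<in> M" by (metis ex_in_conv surj_pair)
      moreover have "w i j = 0" using ij sub w by blast
      ultimately have "(\<Prod>(i,j)\<in>M. w i j) = 0" by (intro prod_zero bexI[of _ "(i, j)"]) simp_all
      thus "(\<Prod>(i,j)\<in>M. w i j) * (\<Prod>i\<in>S - fst ` M. Y i) * (\<Prod>j\<in>T - snd ` M. Z j) = 0" by simp
    qed
  qed (auto simp: finite_matchings assms, auto simp: matchings_def)
  thus ?thesis by simp
qed

section \<open>Dependence on a single weight\<close>

lemma matching_poly_add_row_weight:
  assumes "finite S" "finite T" "i \<in> S"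
  shows "matching_poly (Y(i := Y i + c)) Z w S T =
           matching_poly Y Z w S T + c * matching_poly Y Z w (S - {i}) T"
proof -
  have "matching_poly (Y(i := Y i + c)) Z w (S - {i}) T' = matching_poly Y Z w (S - {i}) T'" for T'
    by (rule matching_poly_cong) auto
  thus ?thesis
    using matching_poly_row[OF assms, of Y Z w] matching_poly_row[OF assms, of "Y(i := Y i + c)" Z w]
    by (simp add: algebra_simps)
qed

lemma matching_poly_add_column_weight:
  assumes "finite S" "finite T" "j \<in> T"
  shows "matching_poly Y (Z(j := Z j + c)) w S T =
           matching_poly Y Z w S T + c * matching_poly Y Z w S (T - {j})"
  using matching_poly_add_row_weight[OF assms(2,1,3), of Z c Y "\<lambda>j i. w i j"]
  unfolding matching_poly_transpose[of Y _ w] .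

text \<open>Deleting row \<open>i\<close> removes every other occurrence of \<open>w i j\<close>.
  The slope equals the coefficient of the product of increments of \<open>Y i\<close> and
  \<open>Z j\<close>; hence trading that product for an edge weight leads to a matching polynomial
  again.\<close>

lemma matching_poly_add_edge_weight:
  assumes "finite S" "finite T" "i \<in> S" "j \<in> T"
  shows "matching_poly Y Z (w(i := (w i)(j := w i j + c))) S T =
           matching_poly Y Z w S T + c * matching_poly Y Z w (S - {i}) (T - {j})"
proof -
  let ?w = "w(i := (w i)(j := w i j + c))"
  have *: "matching_poly Y Z ?w (S - {i}) T' = matching_poly Y Z w (S - {i}) T'" for T'
    by (rule matching_poly_cong) auto
  have "(\<Sum>l\<in>T. ?w i l * matching_poly Y Z w (S - {i}) (T - {l})) =
    (\<Sum>l\<in>T. w i l * matching_poly Y Z w (S - {i}) (T - {l})) +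
    (\<Sum>l\<in>T. if l = j then c * matching_poly Y Z w (S - {i}) (T - {j}) else 0)"
    unfolding sum.distrib[symmetric] by (rule sum.cong) (auto simp: algebra_simps)
  also have "\<dots> = (\<Sum>l\<in>T. w i l * matching_poly Y Z w (S - {i}) (T - {l})) +
      c * matching_poly Y Z w (S - {i}) (T - {j})"
    using assms by (simp add: sum.delta')
  finally show ?thesis
    using matching_poly_row[OF assms(1-3), of Y Z w] matching_poly_row[OF assms(1-3), of Y Z ?w]
    by (simp only: *)
qed

section \<open>Correlation between deletions of vertices\<close>

text \<open>
  Both parts are proved by a simultaneous induction: the first needs the second after the deletion
  of a column, the second needs the first after the deletion of a row.
\<close>
lemma matching_poly_correlation:
  assumes "finite S" "finite T"
    and Y: "\<And>i. i \<in> S \<Longrightarrow> Y i \<ge> 0" and Z: "\<And>j. j \<in> T \<Longrightarrow> Z j \<ge> 0"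
    and w: "\<And>i j. i \<in> S \<Longrightarrow> j \<in> T \<Longrightarrow> w i j \<ge> 0"
  defines "f \<equiv> matching_poly Y Z w"
  shows "(\<forall>i\<in>S. \<forall>j\<in>T. f (S - {i}) T * f S (T - {j}) \<le> f S T * f (S - {i}) (T - {j})) \<and>
         (\<forall>i\<in>S. \<forall>k\<in>S. i \<noteq> k \<longrightarrow> f S T * f (S - {i} - {k}) T \<le> f (S - {i}) T * f (S - {k}) T)"
  using assms(1-5)
proof (induction "card S + card T" arbitrary: S T rule: less_induct)
  case less
  note fin = less.prems(1,2)
  show ?case
  proof (intro conjI ballI impI)
    fix i j assume ij: "i \<in> S" "j \<in> T"
    have "card (T - {j}) < card T" using ij fin by (intro psubset_card_mono) auto
    hence IH: "f S (T - {j}) * f (S - {i} - {k}) (T - {j}) \<le> f (S - {i}) (T - {j}) * f (S - {k}) (T - {j})"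
      if "k \<in> S" "k \<noteq> i" for k
      using less.hyps[of S "T - {j}"] less.prems that ij by auto
    \<comment> \<open>Expand along column \<open>j\<close>. After cross-multiplication the
      \<open>Z j\<close> terms agree, and the sums compare termwise by the second part of the
      induction hypothesis for \<open>T - {j}\<close>. The term \<open>k = i\<close>, present only
      in the first expansion, is nonnegative.\<close>
    have E: "f S T = Z j * f S (T - {j}) + (\<Sum>k\<in>S. w k j * f (S - {k}) (T - {j}))"
      "f (S - {i}) T = Z j * f (S - {i}) (T - {j}) + (\<Sum>k\<in>S - {i}. w k j * f (S - {i} - {k}) (T - {j}))"
      unfolding f_def using fin ij by (auto intro: matching_poly_column)
    have "(\<Sum>k\<in>S - {i}. w k j * f (S - {i} - {k}) (T - {j})) * f S (T - {j}) \<le>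
          (\<Sum>k\<in>S - {i}. w k j * f (S - {k}) (T - {j})) * f (S - {i}) (T - {j})"
      unfolding sum_distrib_right
    proof (rule sum_mono)
      fix k assume k: "k \<in> S - {i}"
      have "w k j * (f S (T - {j}) * f (S - {i} - {k}) (T - {j})) \<le>
            w k j * (f (S - {i}) (T - {j}) * f (S - {k}) (T - {j}))"
        using k IH less.prems ij by (intro mult_left_mono) auto
      thus "w k j * f (S - {i} - {k}) (T - {j}) * f S (T - {j}) \<le>
          w k j * f (S - {k}) (T - {j}) * f (S - {i}) (T - {j})" by (simp add: mult_ac)
    qed
    also have "\<dots> \<le> (\<Sum>k\<in>S. w k j * f (S - {k}) (T - {j})) * f (S - {i}) (T - {j})"
    proof (intro mult_right_mono sum_mono2)
      show "0 \<le> f (S - {i}) (T - {j})"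
        unfolding f_def using less.prems by (intro matching_poly_nonneg) auto
      show "0 \<le> w b j * f (S - {b}) (T - {j})" if "b \<in> S - (S - {i})" for b
        unfolding f_def using less.prems ij that by (intro matching_poly_nonneg mult_nonneg_nonneg) auto
    qed (use fin in auto)
    finally show "f (S - {i}) T * f S (T - {j}) \<le> f S T * f (S - {i}) (T - {j})"
      unfolding E by (simp add: algebra_simps)
  next
    fix i k assume ik: "i \<in> S" "k \<in> S" "i \<noteq> k"
    have "card (S - {k}) < card S" using ik fin by (intro psubset_card_mono) auto
    hence IH: "f (S - {k} - {i}) T * f (S - {k}) (T - {l}) \<le> f (S - {k}) T * f (S - {k} - {i}) (T - {l})"
      if "l \<in> T" for l
      using less.hyps[of "S - {k}" T] less.prems that ik by auto
    have comm: "S - {i} - {k} = S - {k} - {i}" by auto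
    \<comment> \<open>Along row \<open>k\<close> the \<open>Y k\<close> terms agree likewise. Both
      sums range over all of \<open>T\<close>, so the first part of the induction hypothesis for
      \<open>S - {k}\<close> suffices termwise.\<close>
    have E: "f S T = Y k * f (S - {k}) T + (\<Sum>l\<in>T. w k l * f (S - {k}) (T - {l}))"
      "f (S - {i}) T = Y k * f (S - {k} - {i}) T + (\<Sum>l\<in>T. w k l * f (S - {k} - {i}) (T - {l}))"
      unfolding f_def comm[symmetric] using fin ik by (auto intro: matching_poly_row)
    have "(\<Sum>l\<in>T. w k l * f (S - {k}) (T - {l})) * f (S - {k} - {i}) T \<le>
          (\<Sum>l\<in>T. w k l * f (S - {k} - {i}) (T - {l})) * f (S - {k}) T"
      unfolding sum_distrib_right
    proof (rule sum_mono)
      fix l assume l: "l \<in> T"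
      have "w k l * (f (S - {k} - {i}) T * f (S - {k}) (T - {l})) \<le>
            w k l * (f (S - {k}) T * f (S - {k} - {i}) (T - {l}))"
        using l IH less.prems ik by (intro mult_left_mono) auto
      thus "w k l * f (S - {k}) (T - {l}) * f (S - {k} - {i}) T \<le>
            w k l * f (S - {k} - {i}) (T - {l}) * f (S - {k}) T" by (simp add: mult_ac)
    qed
    thus "f S T * f (S - {i} - {k}) T \<le> f (S - {i}) T * f (S - {k}) T"
      unfolding E comm by (simp add: algebra_simps)
  qed
qed

section \<open>Elimination of the edge variables\<close>

text \<open>
  The hypothesis at \<open>u * v = x\<close>, with \<open>u\<close> and \<open>v\<close> balanced so that \<open>b * u = c * v\<close>, gives
  \<open>K * x powr q \<le> (a + q * d) * (1 + q * x)\<close>; the best choice is \<open>x = 1 / (1 - q)\<close>. The number \<open>e\<close>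
  in the proof avoids division by 0 when \<open>b\<close> or \<open>c\<close> vanishes.
\<close>
lemma capacity_step:
  fixes a b c d q K :: real
  assumes nn: "a \<ge> 0" "b \<ge> 0" "c \<ge> 0" "d \<ge> 0" and bc: "b * c \<le> a * d" and q: "0 \<le> q" "q \<le> 1"
    and K: "\<And>u v. u > 0 \<Longrightarrow> v > 0 \<Longrightarrow>
      K * (u * v) powr q \<le> a + q * u * b + q * v * c + q * u * (q * v) * d"
  shows "K * rpow0 (1 - q) (1 - q) \<le> a + q * d"
proof -
  have main: "K * x powr q \<le> (a + q * d) * (1 + q * x)" if x: "x > 0" for x
  proof -
    have "K * x powr q \<le> a + 2 * q * sqrt ((b + e) * (c + e) * x) + q\<^sup>2 * x * d" if e: "e > 0" for e
    proof -
      define \<beta> \<gamma> \<xi> where "\<beta> = sqrt (b + e)" and "\<gamma> = sqrt (c + e)" and "\<xi> = sqrt x"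
      define u v where "u = \<gamma> * \<xi> / \<beta>" and "v = \<beta> * \<xi> / \<gamma>"
      have pos: "\<beta> > 0" "\<gamma> > 0" "\<xi> > 0" using e nn x by (auto simp: \<beta>_def \<gamma>_def \<xi>_def)
      have sq: "b + e = \<beta> * \<beta>" "c + e = \<gamma> * \<gamma>" "x = \<xi> * \<xi>"
        using e nn x by (auto simp: \<beta>_def \<gamma>_def \<xi>_def)
      have uv: "u > 0" "v > 0" using pos by (auto simp: u_def v_def)
      have uvx: "u * v = x" unfolding sq(3) u_def v_def using pos by simp
      have r: "sqrt ((b + e) * (c + e) * x) = \<beta> * \<gamma> * \<xi>"
        by (simp add: real_sqrt_mult \<beta>_def \<gamma>_def \<xi>_def)
      have bu: "(b + e) * u = sqrt ((b + e) * (c + e) * x)"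
        unfolding r unfolding sq u_def using pos by simp
      have cv: "(c + e) * v = sqrt ((b + e) * (c + e) * x)"
        unfolding r unfolding sq v_def using pos by simp
      have "K * x powr q \<le> a + q * (b * u) + q * (c * v) + q\<^sup>2 * (u * v) * d"
        using K[OF uv] by (simp add: uvx[symmetric] power2_eq_square mult_ac)
      also have "\<dots> \<le> a + q * ((b + e) * u) + q * ((c + e) * v) + q\<^sup>2 * (u * v) * d"
        using uv e q by (intro add_mono mult_left_mono mult_right_mono) auto
      finally show ?thesis by (simp add: bu cv uvx)
    qed
    \<comment> \<open>The bound obtained, unlike \<open>u\<close> and \<open>v\<close> themselves,
      is continuous at \<open>e = 0\<close>.\<close>
    moreover have "((\<lambda>e. a + 2 * q * sqrt ((b + e) * (c + e) * x) + q\<^sup>2 * x * d) \<longlongrightarrow>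
        a + 2 * q * sqrt ((b + 0) * (c + 0) * x) + q\<^sup>2 * x * d) (at_right 0)"
      by (intro tendsto_intros)
    ultimately have "K * x powr q \<le> a + 2 * q * sqrt ((b + 0) * (c + 0) * x) + q\<^sup>2 * x * d"
      by (intro tendsto_lowerbound[of _ _ "at_right 0"])
         (auto simp: eventually_at_right_less eventually_at_filter)
    \<comment> \<open>Here \<open>b * c \<le> a * d\<close> enters: AM-GM for \<open>a * x\<close>
      and \<open>d\<close> replaces the square root by the very cross term that makes the bound
      factor as \<open>(a + q * d) * (1 + q * x)\<close>.\<close>
    also have "2 * sqrt (b * c * x) \<le> a * x + d"
    proof -
      have "2 * sqrt (b * c * x) \<le> 2 * sqrt ((a * x) * d)"
        using bc x by (simp add: mult_ac)
      also have "\<dots> \<le> a * x + d"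
        using arith_geo_mean_sqrt[of "a * x" d] nn x by simp
      finally show ?thesis .
    qed
    hence "2 * q * sqrt ((b + 0) * (c + 0) * x) \<le> q * (a * x + d)"
      using mult_left_mono[of "2 * sqrt (b * c * x)" "a * x + d" q] q(1) by (simp add: mult_ac)
    finally show ?thesis by (simp add: algebra_simps power2_eq_square)
  qed
  show ?thesis
  proof (cases "q = 1")
    case False
    hence p: "1 - q > 0" using q by simp
    have "K * (1 - q) powr (- q) \<le> (a + q * d) * (1 + q / (1 - q))"
      using main[of "1 / (1 - q)"] p by (simp add: powr_divide powr_minus_divide)
    also have "1 + q / (1 - q) = 1 / (1 - q)" using p by (simp add: field_simps)
    finally have "K * (1 - q) powr (- q) * (1 - q) \<le> a + q * d" using p by (simp add: field_simps)
    moreover have "(1 - q) powr (- q) * (1 - q) = (1 - q) powr (1 - q)"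
      using p powr_add[of "1 - q" "- q" 1] by simp
    ultimately show ?thesis using p by (simp add: rpow0_def mult.assoc)
  next
    case True
    \<comment> \<open>For \<open>q = 1\<close> the optimal \<open>x\<close> escapes to infinity, so
      the bound is a limit; the lost factor is then \<open>rpow0 0 0 = 1\<close>.\<close>
    have "K \<le> (a + d) * (1 + inverse x)" if "x > 0" for x
      using main[OF that] that True by (simp add: field_simps)
    moreover have "((\<lambda>x. (a + d) * (1 + inverse x)) \<longlongrightarrow> (a + d) * (1 + 0)) at_top"
      by (intro tendsto_intros tendsto_inverse_0_at_top filterlim_ident)
    ultimately have "K \<le> (a + d) * (1 + 0)"
      by (intro tendsto_lowerbound[of _ _ at_top]) (auto intro: eventually_mono[OF eventually_gt_at_top[of 0]])
    thus ?thesis using True by (simp add: rpow0_def)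
  qed
qed

text \<open>Jensen's inequality for \<open>exp\<close> at the points
  \<open>ln (y i)\<close>.\<close>

lemma weighted_am_gm:
  fixes q y :: "'a \<Rightarrow> real"
  assumes "finite A" "\<And>i. i \<in> A \<Longrightarrow> q i \<ge> 0" "(\<Sum>i\<in>A. q i) = 1" "\<And>i. i \<in> A \<Longrightarrow> y i > 0"
  shows "(\<Prod>i\<in>A. y i powr q i) \<le> (\<Sum>i\<in>A. q i * y i)"
proof -
  have ne: "A \<noteq> {}" using assms(3) by auto
  have "(\<Prod>i\<in>A. y i powr q i) = (\<Prod>i\<in>A. exp (q i * ln (y i)))"
    using assms(4) by (intro prod.cong) (auto simp: powr_def less_imp_neq[symmetric])
  also have "\<dots> = exp (\<Sum>i\<in>A. q i *\<^sub>R ln (y i))" using assms(1) by (simp add: exp_sum)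
  also have "\<dots> \<le> (\<Sum>i\<in>A. q i * exp (ln (y i)))"
    by (rule convex_on_sum[OF assms(1) ne exp_convex]) (use assms in auto)
  also have "\<dots> = (\<Sum>i\<in>A. q i * y i)" using assms(4) by (intro sum.cong) auto
  finally show ?thesis .
qed

text \<open>\<open>R\<close> is the set of edges whose variables are still present.\<close>
lemma capacity_elimination:
  fixes Q :: "'a \<Rightarrow> 'b \<Rightarrow> real"
  assumes fin: "finite S" "finite T" and Q: "\<And>i j. i \<in> S \<Longrightarrow> j \<in> T \<Longrightarrow> 0 \<le> Q i j \<and> Q i j \<le> 1"
    and "finite R" "R \<subseteq> S \<times> T"
    and "\<And>y z. (\<And>i j. y i j > 0) \<Longrightarrow> (\<And>i j. z i j > 0) \<Longrightarrow>
      C * (\<Prod>(i,j)\<in>R. (y i j * z i j) powr Q i j) \<le>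
        matching_poly (\<lambda>i. \<Sum>j\<in>R `` {i}. Q i j * y i j) (\<lambda>j. \<Sum>i\<in>R\<inverse> `` {j}. Q i j * z i j)
          (\<lambda>i j. if (i, j) \<in> R then 0 else Q i j) S T"
  shows "C * (\<Prod>(i,j)\<in>R. rpow0 (1 - Q i j) (1 - Q i j)) \<le> matching_poly (\<lambda>_. 0) (\<lambda>_. 0) Q S T"
  using assms(4-6)
proof (induction R arbitrary: C rule: finite_induct)
  case empty
  show ?case using empty(2)[of "\<lambda>_ _. 1" "\<lambda>_ _. 1"] by simp
next
  case (insert e R)
  obtain i j where e: "e = (i, j)" by (cases e)
  have ij: "i \<in> S" "j \<in> T" and R: "R \<subseteq> S \<times> T" "(i, j) \<notin> R" using insert.prems insert.hyps e by auto
  have finR: "finite (R `` A)" "finite (R\<inverse> `` B)" for A B using insert.hyps(1) by auto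
  let ?q = "Q i j"
  \<comment> \<open>The loss of the edge \<open>(i, j)\<close> is absorbed into the constant, which
    is why the induction keeps \<open>C\<close> arbitrary.\<close>
  have "C * rpow0 (1 - ?q) (1 - ?q) * (\<Prod>(i,j)\<in>R. rpow0 (1 - Q i j) (1 - Q i j))
      \<le> matching_poly (\<lambda>_. 0) (\<lambda>_. 0) Q S T"
  proof (rule insert.IH[OF R(1)])
    fix y z :: "'a \<Rightarrow> 'b \<Rightarrow> real"
    assume pos: "\<And>i j. y i j > 0" "\<And>i j. z i j > 0"
    define Y where "Y i = (\<Sum>j\<in>R `` {i}. Q i j * y i j)" for i
    define Z where "Z j = (\<Sum>i\<in>R\<inverse> `` {j}. Q i j * z i j)" for j
    \<comment> \<open>\<open>Y\<close> and \<open>Z\<close> no longer contain the variables of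
      \<open>(i, j)\<close>, while \<open>W\<close> does not yet give this edge its weight:
      \<open>f S T\<close> is the polynomial with both variables set to 0.\<close>
    define W where "W i' j' = (if (i', j') \<in> insert (i, j) R then 0 else Q i' j')" for i' j'
    define f where "f = matching_poly Y Z W"
    have QR: "Q k l \<ge> 0" if "(k, l) \<in> R" for k l using that R(1) Q by blast
    have nn: "Y i' \<ge> 0" for i'
      unfolding Y_def by (intro sum_nonneg mult_nonneg_nonneg QR less_imp_le[OF pos(1)]) simp
    have nn': "Z j' \<ge> 0" for j'
      unfolding Z_def by (intro sum_nonneg mult_nonneg_nonneg QR less_imp_le[OF pos(2)]) simp
    have nnW: "W i' j' \<ge> 0" if "i' \<in> S" "j' \<in> T" for i' j' using that Q by (auto simp: W_def)
    have nnf: "f S' T' \<ge> 0" if "S' \<subseteq> S" "T' \<subseteq> T" for S' T'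
      unfolding f_def using that by (intro matching_poly_nonneg nn nn' nnW) auto
    have W': "(\<lambda>i j. if (i, j) \<in> R then 0 else Q i j) = W(i := (W i)(j := W i j + ?q))"
      by (intro ext) (use R(2) in \<open>auto simp: W_def\<close>)
    have corr: "f (S - {i}) T * f S (T - {j}) \<le> f S T * f (S - {i}) (T - {j})"
      unfolding f_def using matching_poly_correlation[OF fin, of Y Z W] nn nn' nnW ij by simp
    define K where "K = C * (\<Prod>(i,j)\<in>R. (y i j * z i j) powr Q i j)"
    have "K * (u * v) powr ?q \<le> f S T + ?q * u * f (S - {i}) T + ?q * v * f S (T - {j})
        + ?q * u * (?q * v) * f (S - {i}) (T - {j})" if uv: "u > 0" "v > 0" for u v
    proof -
      \<comment> \<open>The hypothesis holds for all positive variables, so those of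
        \<open>(i, j)\<close> alone may be set to \<open>u\<close> and \<open>v\<close>; the
        contribution of the others is constant and sits in \<open>K\<close>.\<close>
      define y' where "y' = y(i := (y i)(j := u))"
      define z' where "z' = z(i := (z i)(j := v))"
      have y'R: "y' k l = y k l" "z' k l = z k l" if "(k, l) \<in> R" for k l
        using that R(2) by (auto simp: y'_def z'_def)
      have 1: "(\<Prod>(i,j)\<in>insert (i, j) R. (y' i j * z' i j) powr Q i j) =
          (u * v) powr ?q * (\<Prod>(i,j)\<in>R. (y i j * z i j) powr Q i j)"
      proof -
        have "(\<Prod>(i,j)\<in>R. (y' i j * z' i j) powr Q i j) = (\<Prod>(i,j)\<in>R. (y i j * z i j) powr Q i j)"
          by (intro prod.cong) (auto simp: y'R)
        thus ?thesis using insert.hyps R by (simp add: y'_def z'_def)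
      qed
      have 2: "(\<lambda>k. \<Sum>l\<in>insert (i, j) R `` {k}. Q k l * y' k l) = Y(i := Y i + ?q * u)"
      proof
        fix k
        have *: "(\<Sum>l\<in>R `` {k}. Q k l * y' k l) = Y k"
          unfolding Y_def by (intro sum.cong) (auto simp: y'R)
        have "insert (i, j) R `` {k} = (if k = i then insert j (R `` {k}) else R `` {k})" by auto
        thus "(\<Sum>l\<in>insert (i, j) R `` {k}. Q k l * y' k l) = (Y(i := Y i + ?q * u)) k"
          using * finR R by (auto simp: y'_def)
      qed
      have 3: "(\<lambda>l. \<Sum>k\<in>(insert (i, j) R)\<inverse> `` {l}. Q k l * z' k l) = Z(j := Z j + ?q * v)"
      proof
        fix l
        have *: "(\<Sum>k\<in>R\<inverse> `` {l}. Q k l * z' k l) = Z l"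
          unfolding Z_def by (intro sum.cong) (auto simp: y'R)
        have "(insert (i, j) R)\<inverse> `` {l} = (if l = j then insert i (R\<inverse> `` {l}) else R\<inverse> `` {l})" by auto
        thus "(\<Sum>k\<in>(insert (i, j) R)\<inverse> `` {l}. Q k l * z' k l) = (Z(j := Z j + ?q * v)) l"
          using * finR R by (auto simp: z'_def)
      qed
      have "C * (\<Prod>(i,j)\<in>insert (i, j) R. (y' i j * z' i j) powr Q i j) \<le>
          matching_poly (Y(i := Y i + ?q * u)) (Z(j := Z j + ?q * v)) W S T"
        using insert.prems(2)[of y' z'] pos uv unfolding e 2 3 W_def[abs_def]
        by (auto simp: y'_def z'_def)
      also have "\<dots> = f S T + ?q * u * f (S - {i}) T + ?q * v * f S (T - {j})
        + ?q * u * (?q * v) * f (S - {i}) (T - {j})"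
        using fin ij by (simp add: f_def matching_poly_add_row_weight matching_poly_add_column_weight algebra_simps)
      finally show ?thesis by (simp add: 1 K_def mult_ac)
    qed
    hence "K * rpow0 (1 - ?q) (1 - ?q) \<le> f S T + ?q * f (S - {i}) (T - {j})"
      using Q[OF ij] by (intro capacity_step[OF _ _ _ _ corr]) (auto intro!: nnf)
    \<comment> \<open>The new term is exactly what \<open>(i, j)\<close> contributes once it carries
      the weight \<open>Q i j\<close>, so this is the polynomial belonging to
      \<open>R\<close>.\<close>
    also have "\<dots> = matching_poly Y Z (\<lambda>i j. if (i, j) \<in> R then 0 else Q i j) S T"
      unfolding W' f_def using fin ij by (simp add: matching_poly_add_edge_weight)
    finally show "C * rpow0 (1 - ?q) (1 - ?q) * (\<Prod>(i,j)\<in>R. (y i j * z i j) powr Q i j) \<le>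
      matching_poly (\<lambda>i. \<Sum>j\<in>R `` {i}. Q i j * y i j) (\<lambda>j. \<Sum>i\<in>R\<inverse> `` {j}. Q i j * z i j)
          (\<lambda>i j. if (i, j) \<in> R then 0 else Q i j) S T"
      by (simp add: K_def Y_def[abs_def] Z_def[abs_def] mult_ac)
  qed
  thus ?case using insert.hyps R e by (simp add: mult_ac)
qed

text \<open>The elimination starts with \<open>C = 1\<close> and all edges in \<open>R\<close>,
  where its hypothesis is AM-GM: each row of \<open>Q\<close> supplies convex weights for
  \<open>y\<close>, each column for \<open>z\<close>.\<close>

lemma bethe_lower_bound:
  fixes Q :: "'a \<Rightarrow> 'b \<Rightarrow> real"
  assumes fin: "finite S" "finite T" and Q: "\<And>i j. i \<in> S \<Longrightarrow> j \<in> T \<Longrightarrow> 0 \<le> Q i j"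
    and rows: "\<And>i. i \<in> S \<Longrightarrow> (\<Sum>j\<in>T. Q i j) = 1"
    and cols: "\<And>j. j \<in> T \<Longrightarrow> (\<Sum>i\<in>S. Q i j) = 1"
  shows "(\<Prod>i\<in>S. \<Prod>j\<in>T. rpow0 (1 - Q i j) (1 - Q i j)) \<le> matching_poly (\<lambda>_. 0) (\<lambda>_. 0) Q S T"
proof -
  have Q1: "Q i j \<le> 1" if "i \<in> S" "j \<in> T" for i j
  proof -
    have "Q i j \<le> (\<Sum>j\<in>T. Q i j)"
      using that fin Q by (intro member_le_sum) simp_all
    thus ?thesis using rows that by simp
  qed
  have "1 * (\<Prod>(i,j)\<in>S \<times> T. rpow0 (1 - Q i j) (1 - Q i j)) \<le> matching_poly (\<lambda>_. 0) (\<lambda>_. 0) Q S T"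
  proof (rule capacity_elimination[OF fin])
    fix y z :: "'a \<Rightarrow> 'b \<Rightarrow> real"
    assume pos: "\<And>i j. y i j > 0" "\<And>i j. z i j > 0"
    have "(\<Prod>(i,j)\<in>S \<times> T. (y i j * z i j) powr Q i j) =
        (\<Prod>i\<in>S. \<Prod>j\<in>T. y i j powr Q i j) * (\<Prod>i\<in>S. \<Prod>j\<in>T. z i j powr Q i j)"
      unfolding prod.cartesian_product[symmetric]
      by (simp add: powr_mult less_imp_le[OF pos(1)] less_imp_le[OF pos(2)] prod.distrib)
    also have "(\<Prod>i\<in>S. \<Prod>j\<in>T. z i j powr Q i j) = (\<Prod>j\<in>T. \<Prod>i\<in>S. z i j powr Q i j)"
      by (rule prod.swap)
    also have "(\<Prod>i\<in>S. \<Prod>j\<in>T. y i j powr Q i j) * \<dots> \<le>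
        (\<Prod>i\<in>S. \<Sum>j\<in>T. Q i j * y i j) * (\<Prod>j\<in>T. \<Sum>i\<in>S. Q i j * z i j)"
    proof (rule mult_mono)
      show "(\<Prod>i\<in>S. \<Prod>j\<in>T. y i j powr Q i j) \<le> (\<Prod>i\<in>S. \<Sum>j\<in>T. Q i j * y i j)"
        by (intro prod_mono conjI prod_nonneg weighted_am_gm fin rows Q pos) simp_all
      show "(\<Prod>j\<in>T. \<Prod>i\<in>S. z i j powr Q i j) \<le> (\<Prod>j\<in>T. \<Sum>i\<in>S. Q i j * z i j)"
        by (intro prod_mono conjI prod_nonneg weighted_am_gm fin cols Q pos) simp_all
      show "0 \<le> (\<Prod>i\<in>S. \<Sum>j\<in>T. Q i j * y i j)"
        by (intro prod_nonneg sum_nonneg mult_nonneg_nonneg Q less_imp_le[OF pos(1)])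
      show "0 \<le> (\<Prod>j\<in>T. \<Prod>i\<in>S. z i j powr Q i j)"
        by (intro prod_nonneg) simp
    qed
    also have "\<dots> = (\<Prod>i\<in>S. \<Sum>j\<in>(S \<times> T) `` {i}. Q i j * y i j) *
        (\<Prod>j\<in>T. \<Sum>i\<in>(S \<times> T)\<inverse> `` {j}. Q i j * z i j)"
    proof -
      have "(S \<times> T) `` {i} = T" if "i \<in> S" for i using that by auto
      moreover have "(S \<times> T)\<inverse> `` {j} = S" if "j \<in> T" for j using that by auto
      ultimately show ?thesis by simp
    qed
    also have "\<dots> = matching_poly (\<lambda>i. \<Sum>j\<in>(S \<times> T) `` {i}. Q i j * y i j)
        (\<lambda>j. \<Sum>i\<in>(S \<times> T)\<inverse> `` {j}. Q i j * z i j)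
        (\<lambda>i j. if (i, j) \<in> S \<times> T then 0 else Q i j) S T"
      by (rule matching_poly_no_edges[OF fin, symmetric]) simp
    finally show "1 * (\<Prod>(i,j)\<in>S \<times> T. (y i j * z i j) powr Q i j) \<le> \<dots>" by simp
  qed (simp_all add: fin Q Q1)
  thus ?thesis by (simp add: prod.cartesian_product)
qed

section \<open>Permanents as matching polynomials\<close>

text \<open>On finite sets, vertex weights 0 kill every matching that leaves a vertex unmatched, so
  only perfect matchings count.\<close>

abbreviation perm :: "('a \<Rightarrow> 'b \<Rightarrow> real) \<Rightarrow> 'a set \<Rightarrow> 'b set \<Rightarrow> real" where
  "perm \<equiv> matching_poly (\<lambda>_. 0) (\<lambda>_. 0)"

lemma per_sub_insert_row:
  assumes fin: "finite S" and i: "i \<notin> S"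
  shows "per_sub P (insert i S) T = (\<Sum>l\<in>T. P i l * per_sub P S (T - {l}))"
proof (cases "finite T")
  case True
  let ?F = "\<lambda>S T. {f \<in> S \<rightarrow>\<^sub>E T. bij_betw f S T}"
  have finF: "finite (?F S T')" if "T' \<subseteq> T" for T'
    using finite_PiE[OF fin, of "\<lambda>_. T'"] finite_subset[OF that True] by simp
  have "(\<Sum>l\<in>T. P i l * per_sub P S (T - {l})) =
      (\<Sum>(l, g)\<in>(SIGMA l:T. ?F S (T - {l})). P i l * (\<Prod>k\<in>S. P k (g k)))"
    unfolding per_sub_def sum_distrib_left
    by (rule sum.Sigma) (use True finF in auto)
  also have "\<dots> = per_sub P (insert i S) T"
    unfolding per_sub_def
  \<comment> \<open>\<open>l\<close> is the image of \<open>i\<close>, and \<open>g\<close> the rest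
    of the bijection, reset to \<open>undefined\<close> at \<open>i\<close> to stay
    extensional.\<close>
  proof (rule sum.reindex_bij_witness[where j = "\<lambda>(l, g). g(i := l)" and i = "\<lambda>f. (f i, f(i := undefined))"])
    fix x assume x: "x \<in> (SIGMA l:T. ?F S (T - {l}))"
    obtain l g where lg: "x = (l, g)" "l \<in> T" "g \<in> S \<rightarrow>\<^sub>E (T - {l})" "bij_betw g S (T - {l})"
      using x by auto
    have "g i = undefined" by (rule PiE_arb[OF lg(3) i])
    thus "(\<lambda>f. (f i, f(i := undefined))) ((\<lambda>(l, g). g(i := l)) x) = x"
      by (simp add: lg(1) fun_upd_idem)
    have "g(i := l) \<in> insert i S \<rightarrow>\<^sub>E T" using lg(2,3) i by (auto simp: PiE_iff extensional_def)
    moreover have "bij_betw (g(i := l)) (insert i S) T"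
    proof -
      have "bij_betw (g(i := l)) S (T - {l})"
        using lg(4) i by (subst bij_betw_cong[of S _ g]) auto
      from notIn_Un_bij_betw[OF i _ this] show ?thesis using lg(2) by (simp add: insert_absorb)
    qed
    ultimately show "(\<lambda>(l, g). g(i := l)) x \<in> ?F (insert i S) T" by (simp add: lg(1))
    have "(\<Prod>k\<in>S. P k ((g(i := l)) k)) = (\<Prod>k\<in>S. P k (g k))"
      using i by (intro prod.cong) auto
    thus "(\<Prod>k\<in>insert i S. P k ((\<lambda>(l, g). g(i := l)) x k)) =
        (\<lambda>(l, g). P i l * (\<Prod>k\<in>S. P k (g k))) x"
      using fin i by (simp add: lg(1))
  next
    fix f assume f: "f \<in> ?F (insert i S) T"
    show "(\<lambda>(l, g). g(i := l)) (f i, f(i := undefined)) = f" by simp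
    have b: "bij_betw f (insert i S) T" and e: "f \<in> insert i S \<rightarrow>\<^sub>E T" using f by auto
    have fi: "f i \<in> T" using e by auto
    have "bij_betw f S (T - {f i})"
      using bij_betw_DiffI[OF b, of "{i}" "{f i}"] i fi by simp
    hence 1: "bij_betw (f(i := undefined)) S (T - {f i})"
      using i by (subst bij_betw_cong[of S _ f]) auto
    have "f(i := undefined) \<in> S \<rightarrow>\<^sub>E (T - {f i})"
      using bij_betw_imp_funcset[OF 1] e i by (auto simp: PiE_iff extensional_def)
    thus "(f i, f(i := undefined)) \<in> (SIGMA l:T. ?F S (T - {l}))" using 1 fi by simp
  qed
  finally show ?thesis ..
next
  case False
  \<comment> \<open>A finite set has no bijection onto an infinite one, so both sides
    vanish.\<close>
  have "\<not> bij_betw f S' T'" if "finite S'" "infinite T'" for f :: "nat \<Rightarrow> nat" and S' T'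
    using that bij_betw_finite[of f S' T'] by auto
  moreover have "infinite (T - {l})" for l using False by simp
  ultimately show ?thesis using fin False by (simp add: per_sub_def)
qed

text \<open>Both sides satisfy the same expansion along a row and agree when there are no
  rows.\<close>

lemma perm_eq_per_sub:
  assumes "finite S" "finite T"
  shows "perm P S T = per_sub P S T"
  using assms
proof (induction S arbitrary: T rule: finite_induct)
  case empty
  have "perm P {} T = (if T = {} then 1 else 0)"
    using matching_poly_no_edges[of "{}" T P] empty by (simp add: card_gt_0_iff)
  moreover have "per_sub P {} T = (if T = {} then 1 else 0)"
    by (cases "T = {}") (simp_all add: per_sub_def bij_betw_def)
  ultimately show ?case by simp
next
  case (insert i S)
  thus ?case
    using matching_poly_row[of "insert i S" T i "\<lambda>_. 0" "\<lambda>_. 0" P] by (simp add: per_sub_insert_row)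
qed

lemma per_sub_scale: "finite S \<Longrightarrow> per_sub (\<lambda>i j. t * P i j) S T = t ^ card S * per_sub P S T"
  by (simp add: per_sub_def prod.distrib sum_distrib_left)

section \<open>Permanents of matrices with constant blocks\<close>

text \<open>The zero block forces the columns of \<open>B\<close> to be matched into
  \<open>S\<close>. If \<open>R\<close> is the set of rows of \<open>S\<close> left over, each of
  the \<open>fact (card B)\<close> bijections between \<open>B\<close> and \<open>S - R\<close> has
  weight \<open>v ^ card B\<close>.\<close>

lemma perm_constant_columns:
  assumes "finite B" "finite S" "finite A" "finite T" "S \<inter> A = {}" "T \<inter> B = {}"
    and "\<And>k j. k \<in> S \<Longrightarrow> j \<in> B \<Longrightarrow> w k j = v" "\<And>k j. k \<in> A \<Longrightarrow> j \<in> B \<Longrightarrow> w k j = 0"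
  shows "perm w (S \<union> A) (T \<union> B) =
    v ^ card B * fact (card B) * (\<Sum>R | R \<subseteq> S \<and> card R + card B = card S. perm w (R \<union> A) T)"
  using assms
proof (induction B arbitrary: S rule: finite_induct)
  case empty
  have "{R. R \<subseteq> S \<and> card R + card {} = card S} = {S}"
    using empty card_subset_eq by auto
  thus ?case by simp
next
  case (insert j B)
  let ?b = "card B"
  have j: "j \<in> T \<union> insert j B" "T \<union> insert j B - {j} = T \<union> B" using insert by auto
  have "perm w (S \<union> A) (T \<union> insert j B) = (\<Sum>k\<in>S \<union> A. w k j * perm w (S \<union> A - {k}) (T \<union> B))"
    using matching_poly_column[of "S \<union> A" "T \<union> insert j B" j "\<lambda>_. 0" "\<lambda>_. 0" w] insert.prems insert.hyps j
    by simp
  also have "\<dots> = (\<Sum>k\<in>S. w k j * perm w (S \<union> A - {k}) (T \<union> B)) +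
      (\<Sum>k\<in>A. w k j * perm w (S \<union> A - {k}) (T \<union> B))"
    using insert.prems by (intro sum.union_disjoint) simp_all
  also have "(\<Sum>k\<in>A. w k j * perm w (S \<union> A - {k}) (T \<union> B)) = 0"
    using insert.prems(7) by (intro sum.neutral) simp
  also have "(\<Sum>k\<in>S. w k j * perm w (S \<union> A - {k}) (T \<union> B)) =
     (\<Sum>k\<in>S. v ^ Suc ?b * fact ?b *
        (\<Sum>R | R \<in> {R. R \<subseteq> S \<and> card R + Suc ?b = card S} \<and> k \<notin> R. perm w (R \<union> A) T))"
  proof (intro sum.cong refl)
    fix k assume k: "k \<in> S"
    have "S \<union> A - {k} = (S - {k}) \<union> A" using k insert.prems by auto
    moreover have "perm w ((S - {k}) \<union> A) (T \<union> B) = v ^ ?b * fact ?b *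
        (\<Sum>R | R \<subseteq> S - {k} \<and> card R + ?b = card (S - {k}). perm w (R \<union> A) T)"
      using insert.prems by (intro insert.IH) auto
    moreover have "{R. R \<subseteq> S - {k} \<and> card R + ?b = card (S - {k})} =
        {R. R \<in> {R. R \<subseteq> S \<and> card R + Suc ?b = card S} \<and> k \<notin> R}"
    proof -
      have "card S = Suc (card (S - {k}))" by (rule card.remove[OF insert.prems(1) k])
      thus ?thesis by (auto simp: subset_Diff_insert)
    qed
    moreover have "w k j = v" using insert.prems(6) k by simp
    ultimately show "w k j * perm w (S \<union> A - {k}) (T \<union> B) = v ^ Suc ?b * fact ?b *
        (\<Sum>R | R \<in> {R. R \<subseteq> S \<and> card R + Suc ?b = card S} \<and> k \<notin> R. perm w (R \<union> A) T)"
      by simp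
  qed
  \<comment> \<open>Double counting: a fixed \<open>R\<close> arises once for each row
    \<open>k\<close> of \<open>S - R\<close> matched to \<open>j\<close>, that is
    \<open>Suc (card B)\<close> times, which turns \<open>fact (card B)\<close> into the next
    factorial.\<close>
  also have "\<dots> = v ^ Suc ?b * fact ?b * (\<Sum>R | R \<subseteq> S \<and> card R + Suc ?b = card S.
      \<Sum>k | k \<in> S \<and> k \<notin> R. perm w (R \<union> A) T)"
    unfolding sum_distrib_left[symmetric]
    using insert.prems(1) by (subst sum.swap_restrict) simp_all
  also have "(\<Sum>R | R \<subseteq> S \<and> card R + Suc ?b = card S. \<Sum>k | k \<in> S \<and> k \<notin> R. perm w (R \<union> A) T) =
     (\<Sum>R | R \<subseteq> S \<and> card R + Suc ?b = card S. real (Suc ?b) * perm w (R \<union> A) T)"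
  proof (intro sum.cong refl)
    fix R assume R: "R \<in> {R. R \<subseteq> S \<and> card R + Suc ?b = card S}"
    have "{k. k \<in> S \<and> k \<notin> R} = S - R" by auto
    moreover have "card (S - R) = Suc ?b"
      using R insert.prems(1) by (subst card_Diff_subset) (auto intro: finite_subset)
    ultimately show "(\<Sum>k | k \<in> S \<and> k \<notin> R. perm w (R \<union> A) T) = real (Suc ?b) * perm w (R \<union> A) T"
      by simp
  qed
  finally show ?case using insert.hyps by (simp add: sum_distrib_left[symmetric] mult_ac)
qed

text \<open>The transposed case with an empty zero block: it treats the border rows once the border
  columns have been used up.\<close>

lemma perm_constant_rows:
  assumes "finite A" "finite R" "finite T" "R \<inter> A = {}"
    and "\<And>k l. k \<in> A \<Longrightarrow> l \<in> T \<Longrightarrow> w k l = v"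
  shows "perm w (R \<union> A) T =
    v ^ card A * fact (card A) * (\<Sum>U | U \<subseteq> T \<and> card U + card A = card T. perm w R U)"
  using perm_constant_columns[of A T "{}" R "\<lambda>j i. w i j" v] assms
  unfolding matching_poly_transpose[of _ _ w] by simp

section \<open>The bordered matrix and the bound for general m\<close>

theorem theorem6p4:
  fixes n m :: nat and P :: "nat \<Rightarrow> nat \<Rightarrow> real" and t :: real
  assumes "doubly_stochastic n P"
    and "1 \<le> m" and "m \<le> n"
    and "t = real m / real n"
  shows "per_m n m P \<ge>
    ((\<Prod>i<n. \<Prod>j<n. rpow0 (1 - t * P i j) (1 - t * P i j)) * G (real n) ^ (2 * (n - m)))
    / (t ^ m * real n powr (- 2 * real n * (1 - t)) * (fact (n - m))\<^sup>2)"
proof -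
  define a where "a = n - m"
  define A where "A = {n..<n + a}"
  let ?S = "{..<n}"
  \<comment> \<open>The corner is 0. The value \<open>1 / n\<close> makes all line sums 1:
    \<open>t + a / n = 1\<close> for the old lines, and \<open>n\<close> entries
    \<open>1 / n\<close> for the border lines.\<close>
  define K where "K i j = (if i < n \<and> j < n then t * P i j else if i < n \<or> j < n then 1 / real n else 0)" for i j
  define h where "h = rpow0 (1 - 1 / real n) (1 - 1 / real n)"
  let ?r = "\<lambda>x. rpow0 (1 - x) (1 - x)"
  have n: "n \<ge> 1" and t: "t > 0" and na: "real n = real m + real a"
    using assms(2-4) by (auto simp: a_def)
  have P: "\<And>i j. i < n \<Longrightarrow> j < n \<Longrightarrow> P i j \<ge> 0" "\<And>i. i < n \<Longrightarrow> (\<Sum>j<n. P i j) = 1"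
    "\<And>j. j < n \<Longrightarrow> (\<Sum>i<n. P i j) = 1"
    using assms(1) by (auto simp: doubly_stochastic_def)
  have A: "finite A" "?S \<inter> A = {}" "card A = a" by (auto simp: A_def)
  have K1: "K i j = t * P i j" if "i < n" "j < n" for i j using that by (simp add: K_def)
  have K2: "K i j = 1 / real n" if "i < n" "j \<in> A" for i j using that by (simp add: K_def A_def)
  have K3: "K i j = 1 / real n" if "i \<in> A" "j < n" for i j using that by (simp add: K_def A_def)
  have K4: "K i j = 0" if "i \<in> A" "j \<in> A" for i j using that by (simp add: K_def A_def)
  have ta: "t + real a * (1 / real n) = 1" using n na assms(4) by (simp add: field_simps)
  \<comment> \<open>Removing the border columns leaves a choice of \<open>m\<close> rows, removing
    the border rows a choice of \<open>m\<close> columns. Each removal costs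
    \<open>(1 / n) ^ a * fact a\<close>, and an \<open>m\<close> by \<open>m\<close> submatrix of
    \<open>t * P\<close> remains.\<close>
  have per: "perm K (?S \<union> A) (?S \<union> A) = (1 / real n) ^ (2 * a) * (fact a)\<^sup>2 * (t ^ m * per_m n m P)"
  proof -
    have cm: "{R. R \<subseteq> ?S \<and> card R + card A = card ?S} = {R. R \<subseteq> ?S \<and> card R = m}"
      using assms(3) A by (auto simp: a_def)
    have "perm K (?S \<union> A) (?S \<union> A) = (1 / real n) ^ a * fact a *
        (\<Sum>R | R \<subseteq> ?S \<and> card R = m. perm K (R \<union> A) ?S)"
      using perm_constant_columns[of A ?S A ?S K "1 / real n"] A K2 K4 cm by simp
    moreover have "(\<Sum>R | R \<subseteq> ?S \<and> card R = m. perm K (R \<union> A) ?S) =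
        (\<Sum>R | R \<subseteq> ?S \<and> card R = m. (1 / real n) ^ a * fact a *
          (\<Sum>U | U \<subseteq> ?S \<and> card U = m. t ^ m * per_sub P R U))"
    proof (intro sum.cong refl)
      fix R assume R: "R \<in> {R. R \<subseteq> ?S \<and> card R = m}"
      hence RA: "R \<inter> A = {}" "finite R" "R \<subseteq> ?S" using A finite_subset by auto
      have "perm K (R \<union> A) ?S = (1 / real n) ^ a * fact a * (\<Sum>U | U \<subseteq> ?S \<and> card U = m. perm K R U)"
        using perm_constant_rows[of A R ?S K "1 / real n"] A K3 cm RA by simp
      also have "(\<Sum>U | U \<subseteq> ?S \<and> card U = m. perm K R U) = (\<Sum>U | U \<subseteq> ?S \<and> card U = m. t ^ m * per_sub P R U)"
      proof (intro sum.cong refl)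
        fix U assume U: "U \<in> {U. U \<subseteq> ?S \<and> card U = m}"
        have fU: "finite U" using U finite_subset by auto
        have "perm K R U = perm (\<lambda>i j. t * P i j) R U"
          using U RA by (intro matching_poly_cong refl K1) auto
        also have "\<dots> = t ^ m * per_sub P R U"
          using fU R RA(2) by (simp add: perm_eq_per_sub per_sub_scale)
        finally show "perm K R U = t ^ m * per_sub P R U" .
      qed
      finally show "perm K (R \<union> A) ?S = (1 / real n) ^ a * fact a *
        (\<Sum>U | U \<subseteq> ?S \<and> card U = m. t ^ m * per_sub P R U)" .
    qed
    moreover have "(1 / real n) ^ (2 * a) = (1 / real n) ^ a * (1 / real n) ^ a"
      by (simp add: mult_2 power_add)
    ultimately show ?thesis
      by (simp only: per_m_def sum_distrib_left[symmetric] power2_eq_square mult_ac)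
  qed
  have "(\<Prod>i\<in>?S \<union> A. \<Prod>j\<in>?S \<union> A. ?r (K i j)) \<le> perm K (?S \<union> A) (?S \<union> A)"
  proof (rule bethe_lower_bound)
    show "0 \<le> K i j" for i j using P(1) t by (simp add: K_def)
    fix i assume i: "i \<in> ?S \<union> A"
    have split: "(\<Sum>j\<in>?S \<union> A. f j) = (\<Sum>j<n. f j) + (\<Sum>j\<in>A. f j)" for f :: "nat \<Rightarrow> real"
      using A by (intro sum.union_disjoint) auto
    show "(\<Sum>j\<in>?S \<union> A. K i j) = 1"
    proof (cases "i < n")
      case True
      thus ?thesis using ta A by (simp add: split K1 K2 sum_distrib_left[symmetric] P)
    next
      case False
      thus ?thesis using i n by (simp add: split K3 K4)
    qed
    show "(\<Sum>j\<in>?S \<union> A. K j i) = 1"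
    proof (cases "i < n")
      case True
      thus ?thesis using ta A by (simp add: split K1 K3 sum_distrib_left[symmetric] P)
    next
      case False
      thus ?thesis using i n by (simp add: split K2 K4)
    qed
  qed (use A in simp_all)
  \<comment> \<open>Each of the \<open>2 * n * a\<close> border entries contributes
    \<open>h\<close>; the zero corner contributes factors \<open>rpow0 1 1 = 1\<close>.\<close>
  moreover have "(\<Prod>i\<in>?S \<union> A. \<Prod>j\<in>?S \<union> A. ?r (K i j)) =
      (\<Prod>i<n. \<Prod>j<n. ?r (t * P i j)) * (h ^ n) ^ (2 * a)"
  proof -
    have split: "(\<Prod>j\<in>?S \<union> A. f j) = (\<Prod>j<n. f j) * (\<Prod>j\<in>A. f j)" for f :: "nat \<Rightarrow> real"
      using A by (intro prod.union_disjoint) auto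
    have "(\<Prod>i\<in>?S \<union> A. \<Prod>j\<in>?S \<union> A. ?r (K i j)) =
        (\<Prod>i<n. (\<Prod>j<n. ?r (t * P i j)) * h ^ a) * (\<Prod>i\<in>A. h ^ n)"
      unfolding split using A by (simp add: K1 K2 K3 K4 h_def rpow0_def[of 1])
    also have "\<dots> = (\<Prod>i<n. \<Prod>j<n. ?r (t * P i j)) * ((h ^ a) ^ n * (h ^ n) ^ a)"
      using A by (simp add: prod.distrib)
    also have "(h ^ a) ^ n * (h ^ n) ^ a = (h ^ n) ^ (2 * a)"
      by (simp add: mult_2 power_add power_commutes flip: power_mult) (simp add: mult.commute)
    finally show ?thesis .
  qed
  \<comment> \<open>The exponents agree because \<open>n * (1 - 1 / n) = n - 1\<close>. For
    \<open>n = 1\<close> both sides are 1 by the convention \<open>0^0 = 1\<close>.\<close>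
  moreover have "h ^ n = G (real n)"
  proof (cases "n = 1")
    case False
    hence n1: "1 - 1 / real n > 0" using n by simp
    have "h ^ n = (1 - 1 / real n) powr (real n * (1 - 1 / real n))"
      using n1 False by (simp add: h_def rpow0_def powr_power mult.commute)
    also have "real n * (1 - 1 / real n) = real n - 1" using n by (simp add: field_simps)
    also have "1 - 1 / real n = (real n - 1) / real n" using n by (simp add: field_simps)
    finally show ?thesis using False n by (simp add: G_def rpow0_def)
  qed (simp add: h_def G_def rpow0_def)
  ultimately have "(\<Prod>i<n. \<Prod>j<n. ?r (t * P i j)) * G (real n) ^ (2 * a) \<le>
      per_m n m P * (t ^ m * (1 / real n) ^ (2 * a) * (fact a)\<^sup>2)"
    by (simp add: per mult_ac)
  moreover have "real n powr (- 2 * real n * (1 - t)) = (1 / real n) ^ (2 * a)"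
  proof -
    \<comment> \<open>Since \<open>n * (1 - t) = a\<close>, the real exponent is an integer.\<close>
    have e: "- 2 * real n * (1 - t) = - real (2 * a)" using ta n by (simp add: field_simps)
    show ?thesis unfolding e using n powr_realpow[of "real n" "2 * a"]
      by (simp add: powr_minus power_one_over inverse_eq_divide)
  qed
  moreover have "0 < t ^ m * (1 / real n) ^ (2 * a) * (fact a)\<^sup>2" using t n by simp
  ultimately show ?thesis by (simp add: pos_divide_le_eq flip: a_def)
qed

end
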